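(* Assume the standing setting and hypothesis (H) below, and let $y_f\in[0,1]^M$. Let $y\in S$ with $\varepsilon$-representative $z\in\mathcal{X}$, let $\pi^\varepsilon_k=\pi^\varepsilon_k(z)$ be the approximate optimal pattern of length $k$ associated to $z$, and let $\mathbf{v}_k(y)=\min_{\pi\in U^k}\|Y^\pi_{k\tau,y}-y_f\|$. Then, with $T=k\tau$, the error $$E_\varepsilon(T):=\Big|\,\|\tilde Y^{\pi^\varepsilon_k}_{k\tau,z}-y_f\|-\mathbf{v}_k(y)\Big|$$ satisfies $E_\varepsilon(T)\le(2k+1)\varepsilon$.
   Context: Setting. Fix integers $M,k\ge1$, reals $L>0$, $\sigma>0$, $\tau>0$, $\varepsilon>0$; $h=L/(M+1)$, $S=[0,1]^M$, Euclidean norm $\|\cdot\|$ and inner product $\langle\cdot,\cdot\rangle$. $\mathcal{L}_h=\frac1{h^2}\mathrm{tridiag}(1,-2,1)$ ($M\times M$). $U\subset[0,1]^2$ is a finite set of modes; for $u=(u_0,u_L)$, $\varphi_h(u)=\frac1{h^2}(u_0,0,\dots,0,u_L)^\top$. A map $f:\mathbb{R}^M\to\mathbb{R}^M$ is given and $f_u(y)=\sigma\mathcal{L}_hy+\sigma\varphi_h(u)+f(y)$, assumed Lipschitz on $S$ with constant $L_u$. $\lambda_u$ is the OSL constant of $f_u$ on $S$ (smallest constant with $\langle f_u(y_1)-f_u(y_2),y_1-y_2\rangle\le\lambda_u\|y_1-y_2\|^2$ for all $y_1,y_2\in S$), and $C_u=\sup_{y\in S}L_u\|f_u(y)\|$.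 Trajectories. For a pattern $\pi=u_k\cdots u_1\in U^k$ and $y\in S$, $Y^\pi_{t,y}$ ($t\in[0,k\tau]$) is the continuous solution of $dy/dt=f_{u_k}(y)$ on $[0,\tau)$ with $Y^\pi_{0,y}=y$, continued by the solution of $dy/dt=f_{u_{k-1}}(y)$ on $[\tau,2\tau)$, and so on up to $f_{u_1}$ on $[(k-1)\tau,k\tau]$. The Euler image is $\tilde Y^u_{t,z}=z+tf_u(z)$ for $t\in[0,\tau]$, and $\tilde Y^\pi_{t,z}=\tilde Y^{u_k}_{t,z}$ for $t\in[0,\tau]$, $\tilde Y^{\pi}_{t,z}=\tilde Y^{u_{k-1}\cdots u_1}_{t-\tau,\tilde Y^{u_k}_{\tau,z}}$ for $t\in[\tau,k\tau]$. It is assumed that all these exact and Euler trajectories remain in $S$. Grid. $K$ is an integer with $K\ge\sqrt{M}/(2\varepsilon)$; $[0,1]$ is split into $K$ equal subintervals, hence $S$ into $K^M$ equal cubic cells; $\mathcal{X}$ is the set of cell centers. The $\varepsilon$-representative of $y\in S$ is the center of a (fixed choice of) cell containing $y$, so $\|y-z\|\le\varepsilon$. Hypothesis (H). For each $u\in U$ let $G_u=\sqrt3\,\varepsilon|\lambda_u|/C_u$ and $\alpha_u=1+\frac{|\lambda_u|G_u}{4}-\sqrt{1+(\lambda_uG_u/4)^2}$. (H) requires, for all $u\in U$: $\lambda_u<0$, $\frac{|\lambda_u|G_u}{4}<1$, and $\tau\le G_u(1-\alpha_u)$. Discrete dynamic programming. For $u\in U$ and $z\in\mathcal{X}$, $next^u(z)$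 is the $\varepsilon$-representative of $z+\tau f_u(z)$. $\mathbf{v}^\varepsilon_0(z)=\|z-y_f\|$ and $\mathbf{v}^\varepsilon_j(z)=\min_{u\in U}\mathbf{v}^\varepsilon_{j-1}(next^u(z))$ for $j\ge1$. $\pi^\varepsilon_0(z)=$ empty word and, for $j\ge1$, $\pi^\varepsilon_j(z)=\mathbf{u}_j(z)\cdot\pi^\varepsilon_{j-1}(next^{\mathbf{u}_j(z)}(z))$ with $\mathbf{u}_j(z)\in\arg\min_{u\in U}\mathbf{v}^\varepsilon_{j-1}(next^u(z))$ (ties broken by a fixed rule); the first letter of a pattern is the mode applied first. *)

theory Defs
  imports "HOL-Analysis.Analysis"
begin

text \<open>R^M is rendered as real^'m, where the index type 'm is a finite linear
order with CARD('m) = M; the k-th coordinate (k = 0..M-1) is the index i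
with pos i = k.\<close>

type_synonym mode = "real \<times> real"

definition cube :: "(real^'m) set" where
  "cube = {x. \<forall>i. 0 \<le> x$i \<and> x$i \<le> 1}"

definition pos :: "'m::{finite,linorder} \<Rightarrow> nat" where
  "pos i = card {j. j < i}"

definition lap :: "real \<Rightarrow> real^('m::{finite,linorder})^('m::{finite,linorder})" where
  "lap h = (\<chi> i j. (if i = j then -2
                     else if pos i + 1 = pos j \<or> pos j + 1 = pos i then 1 else 0) / h^2)"

definition phi :: "real \<Rightarrow> mode \<Rightarrow> real^'m::{finite,linorder}" where
  "phi h u = (\<chi> i. ((if pos i = 0 then fst u else 0)
                    + (if pos i = CARD('m) - 1 then snd u else 0)) / h^2)"

definition fmode :: "real \<Rightarrow> real \<Rightarrow> (real^('m::{finite,linorder}) \<Rightarrow> real^('m::{finite,linorder})) \<Rightarrow> mode \<Rightarrow> real^('m::{finite,linorder}) \<Rightarrow> real^('m::{finite,linorder})" where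
  "fmode L \<sigma> f u y =
     \<sigma> *\<^sub>R (lap (L / real (CARD('m) + 1)) *v y)
     + \<sigma> *\<^sub>R phi (L / real (CARD('m) + 1)) u + f y"

definition osl_const :: "('a::real_inner \<Rightarrow> 'a) \<Rightarrow> 'a set \<Rightarrow> real" where
  "osl_const F A = Inf {c. \<forall>y1\<in>A. \<forall>y2\<in>A. inner (F y1 - F y2) (y1 - y2) \<le> c * (norm (y1 - y2))^2}"

definition C_const :: "real \<Rightarrow> ('a::real_normed_vector \<Rightarrow> 'a) \<Rightarrow> 'a set \<Rightarrow> real" where
  "C_const Lu F A = Sup ((\<lambda>y. Lu * norm (F y)) ` A)"

definition G_const :: "real \<Rightarrow> real \<Rightarrow> real \<Rightarrow> real" where
  "G_const \<epsilon> lam C = sqrt 3 * \<epsilon> * \<bar>lam\<bar> / C"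

definition alpha_const :: "real \<Rightarrow> real \<Rightarrow> real" where
  "alpha_const lam G = 1 + \<bar>lam\<bar> * G / 4 - sqrt (1 + (lam * G / 4)^2)"

definition hypH :: "real \<Rightarrow> real \<Rightarrow> real \<Rightarrow> real \<Rightarrow> bool" where
  "hypH \<epsilon> \<tau> lam C \<longleftrightarrow>
     (let G = G_const \<epsilon> lam C in
       lam < 0 \<and> \<bar>lam\<bar> * G / 4 < 1 \<and> \<tau> \<le> G * (1 - alpha_const lam G))"

text \<open>Patterns are lists whose head is the mode applied first.
 Y is an exact trajectory of pattern pi from y: on the j-th interval
 [j tau, (j+1) tau] it solves dy/dt = F (pi!j) y.\<close>
definition is_traj :: "real \<Rightarrow> (mode \<Rightarrow> 'a::real_normed_vector \<Rightarrow> 'a) \<Rightarrow> mode list \<Rightarrow> 'a \<Rightarrow> (real \<Rightarrow> 'a) \<Rightarrow> bool" where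
  "is_traj \<tau> F \<pi> y Y \<longleftrightarrow> Y 0 = y \<and> continuous_on {0..real (length \<pi>) * \<tau>} Y \<and>
     (\<forall>j<length \<pi>. \<forall>t\<in>{real j * \<tau>..real (Suc j) * \<tau>}.
        (Y has_vector_derivative F (\<pi>!j) (Y t)) (at t within {real j * \<tau>..real (Suc j) * \<tau>}))"

fun euler_traj :: "real \<Rightarrow> (mode \<Rightarrow> 'a \<Rightarrow> 'a) \<Rightarrow> mode list \<Rightarrow> 'a \<Rightarrow> real \<Rightarrow> 'a::real_normed_vector" where
  "euler_traj \<tau> F [] z t = z"
| "euler_traj \<tau> F (u # \<pi>) z t =
     (if t \<le> \<tau> \<or> \<pi> = [] then z + t *\<^sub>R F u z
      else euler_traj \<tau> F \<pi> (z + \<tau> *\<^sub>R F u z) (t - \<tau>))"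

definition grid :: "nat \<Rightarrow> (real^'m) set" where
  "grid K = {c. \<forall>i. \<exists>n::nat. n < K \<and> c$i = (real n + 1/2) / real K}"

definition in_cell :: "nat \<Rightarrow> real^'m \<Rightarrow> real^'m \<Rightarrow> bool" where
  "in_cell K c y \<longleftrightarrow> (\<forall>i. \<bar>y$i - c$i\<bar> \<le> 1 / (2 * real K))"

fun vdp :: "mode set \<Rightarrow> (mode \<Rightarrow> 'a::real_normed_vector \<Rightarrow> 'a) \<Rightarrow> 'a \<Rightarrow> nat \<Rightarrow> 'a \<Rightarrow> real" where
  "vdp U nxt yf 0 z = norm (z - yf)"
| "vdp U nxt yf (Suc j) z = Min ((\<lambda>u. vdp U nxt yf j (nxt u z)) ` U)"

fun pidp :: "(nat \<Rightarrow> 'a \<Rightarrow> mode) \<Rightarrow> (mode \<Rightarrow> 'a \<Rightarrow> 'a) \<Rightarrow> nat \<Rightarrow> 'a \<Rightarrow> mode list" where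
  "pidp sel nxt 0 z = []"
| "pidp sel nxt (Suc j) z = sel (Suc j) z # pidp sel nxt j (nxt (sel (Suc j) z) z)"

definition vexact :: "real \<Rightarrow> mode set \<Rightarrow> (mode list \<Rightarrow> 'a::real_normed_vector \<Rightarrow> real \<Rightarrow> 'a) \<Rightarrow> 'a \<Rightarrow> nat \<Rightarrow> 'a \<Rightarrow> real" where
  "vexact \<tau> U Y yf k y =
     Min ((\<lambda>\<pi>. norm (Y \<pi> y (real k * \<tau>) - yf)) ` {\<pi>. set \<pi> \<subseteq> U \<and> length \<pi> = k})"

end

theory Submission
  imports Defs
begin

text \<open>Put \<open>a = - \<lambda>\<close>, which is the same for every mode because the maps \<open>f\<^sub>u\<close> differ by constants,
  and \<open>E = exp (- a \<tau>)\<close>. A Gronwall estimate that is linear in the error, together with (H), shows that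
  one Euler step from \<open>z\<close> ends within \<open>E \<parallel>y - z\<parallel> + (1 - E) \<epsilon>\<close> of the exact flow from \<open>y\<close>.
  Let \<open>D\<^sub>j\<close> be the distance between the optimal exact trajectory and the grid path with
  the same pattern, and \<open>r\<^sub>j\<close> the distance between the Euler path and the grid path of the pattern
  computed by dynamic programming. Then
  \<open>D\<^sub>j\<^sub>+\<^sub>1 \<le> E D\<^sub>j + (1 - E) \<epsilon> + \<epsilon>\<close> and \<open>r\<^sub>j\<^sub>+\<^sub>1 \<le> E r\<^sub>j + 2 (1 - E) \<epsilon> + \<epsilon>\<close>.
  Bounding the two separately is too weak by \<open>\<epsilon>\<close>, but as \<open>E\<close> is common to both, the excess in \<open>r\<close> is
  paid for by the contraction in \<open>D\<close>: the sum satisfies \<open>D\<^sub>j + r\<^sub>j \<le> (2 j + 1) \<epsilon>\<close> for \<open>j \<ge> 1\<close>.\<close>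

section \<open>One-step error of the Euler scheme\<close>

lemma perturbed_osl_bound:
  fixes X :: "real \<Rightarrow> 'a::real_inner"
  assumes \<tau>: "0 < \<tau>" and a: "0 < a" and C: "0 \<le> C"
    and deriv: "\<And>t. t \<in> {0..\<tau>} \<Longrightarrow> (X has_vector_derivative F (X t)) (at t within {0..\<tau>})"
    and X: "\<And>t. t \<in> {0..\<tau>} \<Longrightarrow> X t \<in> S"
    and eul: "\<And>t. t \<in> {0..\<tau>} \<Longrightarrow> z + t *\<^sub>R F z \<in> S"
    and osl: "\<And>x y. x \<in> S \<Longrightarrow> y \<in> S \<Longrightarrow> inner (F x - F y) (x - y) \<le> - a * (norm (x - y))\<^sup>2"
    and lip: "lipschitz_on l S F" and lC: "l * norm (F z) \<le> C"
  shows "norm (X \<tau> - (z + \<tau> *\<^sub>R F z))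
    \<le> exp (- a * \<tau>) * norm (X 0 - z) + C * (a * \<tau> - 1 + exp (- a * \<tau>)) / a\<^sup>2"
proof (rule field_le_epsilon)
  fix \<delta> :: real assume \<delta>: "0 < \<delta>"
  \<comment> \<open>The slack \<open>\<delta>\<close> keeps \<open>g\<close> positive even if
    \<open>X 0 = z\<close>, so that \<open>Q\<close> may divide by it.\<close>
  define d where "d = norm (X 0 - z) + \<delta>"
  have d: "0 < d" "norm (X 0 - z) \<le> d" using \<delta> by (auto simp: d_def add_nonneg_pos)
  define g where "g t = d * exp (- a * t) + C * (a * t - 1 + exp (- a * t)) / a\<^sup>2" for t
  define e where "e t = X t - (z + t *\<^sub>R F z)" for t
  \<comment> \<open>With \<open>N = \<parallel>e\<parallel>\<^sup>2\<close>, AM-GM in the form \<open>2 \<parallel>e\<parallel> \<le> N / g + g\<close> gives \<open>(N - g\<^sup>2)' \<le> (g' / g - a) (N - g\<^sup>2)\<close>;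
    \<open>Q\<close> is \<open>N - g\<^sup>2\<close> times the integrating factor, and avoids differentiating the norm at 0.\<close>
  define Q where "Q t = (inner (e t) (e t) / g t - g t) * exp (a * t)" for t
  have gpos: "0 < g t" for t
    using d(1) C exp_ge_add_one_self[of "- a * t"] unfolding g_def
    by (intro add_pos_nonneg mult_pos_pos divide_nonneg_nonneg mult_nonneg_nonneg) auto
  have g': "(g has_real_derivative (- a * g t + C * t)) (at t within A)" for t A
    unfolding g_def using a
    by (auto intro!: derivative_eq_intros simp: field_simps power2_eq_square)
  have e': "(e has_vector_derivative (F (X t) - F z)) (at t within {0..\<tau>})" if "t \<in> {0..\<tau>}" for t
    unfolding e_def by (auto intro!: derivative_eq_intros deriv that)
  have n': "((\<lambda>t. inner (e t) (e t)) has_real_derivative (2 * inner (F (X t) - F z) (e t))) (at t within {0..\<tau>})"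
    if "t \<in> {0..\<tau>}" for t
    using has_derivative_inner[OF e'[OF that, unfolded has_vector_derivative_def] e'[OF that, unfolded has_vector_derivative_def]]
    unfolding has_field_derivative_def
    by (rule has_derivative_eq_rhs) (auto simp: inner_commute algebra_simps fun_eq_iff)
  define Q' where "Q' t = ((2 * inner (F (X t) - F z) (e t) * g t - inner (e t) (e t) * (- a * g t + C * t)) / (g t * g t)
        - (- a * g t + C * t)) * exp (a * t) + (inner (e t) (e t) / g t - g t) * (a * exp (a * t))" for t
  have Q': "(Q has_real_derivative Q' t) (at t within {0..\<tau>})" if "t \<in> {0..\<tau>}" for t
    unfolding Q_def Q'_def
    using gpos[of t] by (auto intro!: derivative_eq_intros n' g' that)
  have neg: "Q' t \<le> 0" if t: "t \<in> {0..\<tau>}" for t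
  proof -
    have zS: "z \<in> S" using eul[of 0] \<tau> by auto
    have "inner (F (X t) - F (z + t *\<^sub>R F z)) (e t) \<le> - a * (norm (e t))\<^sup>2"
      unfolding e_def by (rule osl[OF X[OF t] eul[OF t]])
    moreover have "inner (F (z + t *\<^sub>R F z) - F z) (e t) \<le> C * t * norm (e t)"
    proof -
      have "norm (F (z + t *\<^sub>R F z) - F z) \<le> l * norm (t *\<^sub>R F z)"
        using lipschitz_onD[OF lip eul[OF t] zS] by (simp add: dist_norm)
      also have "\<dots> = t * (l * norm (F z))" using t by simp
      also have "\<dots> \<le> t * C" using lC t by (intro mult_left_mono) auto
      finally have "norm (F (z + t *\<^sub>R F z) - F z) * norm (e t) \<le> (t * C) * norm (e t)"
        by (rule mult_right_mono) simp
      then show ?thesis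
        using norm_cauchy_schwarz[of "F (z + t *\<^sub>R F z) - F z" "e t"] by (simp add: mult.commute)
    qed
    ultimately have i: "inner (F (X t) - F z) (e t) \<le> - a * (norm (e t))\<^sup>2 + C * t * norm (e t)"
      by (simp add: inner_diff_left)
    define p where "p = inner (F (X t) - F z) (e t)"
    define n where "n = norm (e t)"
    \<comment> \<open>The equation for \<open>g\<close> and the integrating factor leave
      \<open>a\<close> only in \<open>p + a * n\<^sup>2\<close>, which \<open>i\<close> bounds by
      \<open>C * t * n\<close>; the rest is minus a square.\<close>
    have "Q' t * (g t * g t) = exp (a * t) * (2 * (p + a * n\<^sup>2) * g t - C * t * (n\<^sup>2 + (g t)\<^sup>2))"
      unfolding Q'_def p_def[symmetric] n_def dot_square_norm using gpos[of t]
      by (simp add: field_simps power2_eq_square)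
    also have "\<dots> \<le> exp (a * t) * (2 * (C * t * n) * g t - C * t * (n\<^sup>2 + (g t)\<^sup>2))"
      using i gpos[of t] unfolding p_def n_def
      by (intro mult_left_mono diff_right_mono mult_right_mono) auto
    also have "\<dots> = - (exp (a * t) * (C * t) * (n - g t)\<^sup>2)"
      by (simp add: power2_eq_square algebra_simps)
    also have "\<dots> \<le> 0" using C t by simp
    finally show ?thesis using gpos[of t] by (simp add: mult_le_0_iff)
  qed
  have "Q \<tau> \<le> Q 0"
  proof (rule DERIV_nonpos_imp_decreasing_open[of 0 \<tau> Q])
    show "\<And>t. 0 < t \<Longrightarrow> t < \<tau> \<Longrightarrow> \<exists>y. (Q has_real_derivative y) (at t) \<and> y \<le> 0"
      using Q' neg by (metis at_within_Icc_at atLeastAtMost_iff less_imp_le)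
    show "continuous_on {0..\<tau>} Q"
      using Q' by (meson DERIV_continuous continuous_on_eq_continuous_within)
  qed (use \<tau> in simp)
  also have "Q 0 \<le> 0"
    using d by (simp add: Q_def e_def g_def dot_square_norm power2_eq_square field_simps mult_mono)
  finally have "(norm (e \<tau>))\<^sup>2 / g \<tau> - g \<tau> \<le> 0"
    by (simp add: Q_def dot_square_norm mult_le_0_iff not_le[symmetric])
  then have "(norm (e \<tau>))\<^sup>2 \<le> (g \<tau>)\<^sup>2"
    using gpos[of \<tau>] by (simp add: field_simps power2_eq_square)
  then have "norm (e \<tau>) \<le> g \<tau>" using gpos[of \<tau>] by (simp add: abs_le_square_iff[symmetric])
  also have "g \<tau> \<le> exp (- a * \<tau>) * norm (X 0 - z) + C * (a * \<tau> - 1 + exp (- a * \<tau>)) / a\<^sup>2 + \<delta>"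
  proof -
    have "\<delta> * exp (- a * \<tau>) \<le> \<delta> * 1" using \<delta> a \<tau> by (intro mult_left_mono) auto
    then show ?thesis unfolding g_def d_def by (simp add: algebra_simps)
  qed
  finally show "norm (X \<tau> - (z + \<tau> *\<^sub>R F z))
    \<le> exp (- a * \<tau>) * norm (X 0 - z) + C * (a * \<tau> - 1 + exp (- a * \<tau>)) / a\<^sup>2 + \<delta>"
    unfolding e_def .
qed

text \<open>Serves \<open>hypH_local_error\<close> with \<open>t = a * \<tau>\<close>. Multiplied by
  \<open>exp t\<close>, it reads \<open>s * (1 - t / 4) + t \<le> exp t * R\<close> with
  \<open>s\<close> and \<open>R\<close> as below.\<close>

lemma sqrt3_exp_ineq:
  fixes t :: real assumes t: "0 \<le> t"
  shows "sqrt 3 * (1 - t / 4) * (t - 1 + exp (- t)) \<le> t * (1 - exp (- t))" 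
proof -
  define s where "s = sqrt (3::real)"
  have s: "1.7 \<le> s" "s \<le> 1.74"
    unfolding s_def by (rule real_le_rsqrt real_le_lsqrt; simp add: power2_eq_square)+
  \<comment> \<open>Use \<open>exp t \<ge> 1 + t + t\<^sup>2/2\<close>; what remains is a quadratic in \<open>t\<close> without real roots.\<close>
  define R where "R = t + s * (1 - t / 4) * (1 - t)"
  have "(1 + t + t\<^sup>2/2) * R - (s * (1 - t / 4) + t)
    = t\<^sup>2 * ((1 - s/2) + (1/2 - 3 * s/8) * t + s/8 * t\<^sup>2)"
    unfolding R_def by (simp add: field_simps power2_eq_square) 
  moreover have "0 \<le> (1 - s/2) + (1/2 - 3 * s/8) * t + s/8 * t\<^sup>2"
  proof -
    have "0.2 * t\<^sup>2 \<le> s/8 * t\<^sup>2" "- 0.16 * t \<le> (1/2 - 3 * s/8) * t" 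
      using s t by (intro mult_right_mono; simp)+
    moreover have "0 \<le> 0.2 * (t - 0.4)\<^sup>2" by simp
    ultimately show ?thesis using s by (simp add: power2_eq_square algebra_simps)
  qed
  ultimately have le: "s * (1 - t / 4) + t \<le> (1 + t + t\<^sup>2/2) * R"
    by (smt (verit) mult_nonneg_nonneg zero_le_power2)
  \<comment> \<open>This sign allows \<open>exp t\<close> to replace its Taylor polynomial as the
    factor of \<open>R\<close>.\<close>
  have Rpos: "0 \<le> R"
  proof -
    have "R = s + (1 - 5 * s/4) * t + s/4 * t\<^sup>2" unfolding R_def by (simp add: field_simps power2_eq_square)
    moreover have "0.4 * t\<^sup>2 \<le> s/4 * t\<^sup>2" "- 1.2 * t \<le> (1 - 5 * s/4) * t" 
      using s t by (intro mult_right_mono; simp)+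
    moreover have "0 \<le> 0.4 * (t - 1.5)\<^sup>2" by simp
    ultimately show ?thesis using s by (simp add: power2_eq_square algebra_simps)
  qed
  have "(1 + t + t\<^sup>2/2) * R \<le> exp t * R"
    using exp_lower_Taylor_quadratic[OF t] Rpos by (intro mult_right_mono) auto
  with le have "exp (- t) * (s * (1 - t / 4) + t) \<le> exp (- t) * (exp t * R)"
    by (intro mult_left_mono) auto
  also have "\<dots> = R" by (simp add: exp_minus)
  finally show ?thesis unfolding R_def s_def[symmetric] by (simp add: field_simps)
qed

text \<open>(H) limits \<open>\<tau>\<close> so that the contraction absorbs the local error: with
  \<open>E = exp (- a * \<tau>)\<close>, an initial distance of at most \<open>\<epsilon>\<close>
  becomes at most \<open>E * \<epsilon> + (1 - E) * \<epsilon> = \<epsilon>\<close>.\<close>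

lemma hypH_local_error:
  assumes H: "hypH \<epsilon> \<tau> (- a) C" and \<tau>: "0 < \<tau>" and \<epsilon>: "0 < \<epsilon>" and C: "0 \<le> C"
  shows "C * (a * \<tau> - 1 + exp (- a * \<tau>)) / a\<^sup>2 \<le> (1 - exp (- a * \<tau>)) * \<epsilon>"
proof -
  define G where "G = G_const \<epsilon> (- a) C"
  have a: "0 < a" and le: "\<tau> \<le> G * (sqrt (1 + (a * G / 4)\<^sup>2) - a * G / 4)"
    using H by (auto simp: hypH_def Let_def G_def alpha_const_def)
  \<comment> \<open>Division by zero yields 0, so \<open>C = 0\<close> would give
    \<open>G = 0\<close> and (H) would force \<open>\<tau> \<le> 0\<close>.\<close>
  have "C \<noteq> 0" using le \<tau> by (auto simp: G_def G_const_def)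
  with C have C: "0 < C" by simp
  have Gdef: "G = sqrt 3 * \<epsilon> * a / C" using a by (simp add: G_def G_const_def)
  then have G: "0 < G" using a \<epsilon> C by simp
  \<comment> \<open>\<open>1 - alpha_const\<close> is the positive root of \<open>r\<^sup>2 + 2 q r = 1\<close>, so (H) reads \<open>r\<^sup>2 + t / 2 \<le> 1\<close>.\<close>
  define q where "q = a * G / 4"
  define r where "r = \<tau> / G"
  define t where "t = a * \<tau>"
  have t: "0 < t" using a \<tau> by (simp add: t_def)
  have r: "0 < r" using \<tau> G by (simp add: r_def)
  have q: "0 < q" using a G by (simp add: q_def)
  have "r + q \<le> sqrt (1 + q\<^sup>2)" using le G by (simp add: r_def q_def field_simps)
  then have "(r + q)\<^sup>2 \<le> 1 + q\<^sup>2" using r q real_le_rsqrt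
    by (metis add_nonneg_nonneg less_imp_le power_mono real_sqrt_pow2 zero_le_one zero_le_power2)
  then have "r\<^sup>2 + 2 * q * r \<le> 1" by (simp add: power2_eq_square algebra_simps)
  moreover have "2 * q * r = t / 2" using G by (simp add: q_def r_def t_def)
  \<comment> \<open>The tangent bound \<open>2 * r - 1 \<le> r\<^sup>2\<close> makes the quadratic
    constraint on \<open>r\<close> linear.\<close>
  moreover have "0 \<le> (r - 1)\<^sup>2" by simp
  ultimately have rt: "r \<le> 1 - t / 4" by (simp add: power2_eq_square algebra_simps)
  have Ca: "C / a\<^sup>2 = sqrt 3 * \<epsilon> * r / t"
    using a C G \<tau> \<epsilon> unfolding r_def t_def Gdef by (simp add: field_simps power2_eq_square)
  have p: "0 \<le> t - 1 + exp (- t)" using exp_ge_add_one_self[of "- t"] by simp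
  have "C * (t - 1 + exp (- t)) / a\<^sup>2 = (\<epsilon> / t) * (sqrt 3 * r * (t - 1 + exp (- t)))"
    by (metis (no_types) Ca times_divide_eq_left mult.commute mult.left_commute mult.assoc)
  also have "\<dots> \<le> (\<epsilon> / t) * (sqrt 3 * (1 - t / 4) * (t - 1 + exp (- t)))"
    using \<epsilon> t rt p by (intro mult_left_mono mult_right_mono) auto
  also have "\<dots> \<le> (\<epsilon> / t) * (t * (1 - exp (- t)))"
    using \<epsilon> t sqrt3_exp_ineq[of t] by (intro mult_left_mono) auto
  also have "\<dots> = (1 - exp (- t)) * \<epsilon>" using t by simp
  finally show ?thesis by (simp add: t_def)
qed

section \<open>Euler iterates and dynamic programming\<close>

lemma euler_traj_end:
  "euler_traj \<tau> F \<pi> z (real (length \<pi>) * \<tau>) = fold (\<lambda>u z. z + \<tau> *\<^sub>R F u z) \<pi> z" if "0 < \<tau>"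
  using that by (induction \<pi> arbitrary: z) (auto simp: algebra_simps mult_le_0_iff)

lemma vdp_le:
  assumes "finite U" "set \<pi> \<subseteq> U"
  shows "vdp U nxt yf (length \<pi>) z \<le> norm (fold nxt \<pi> z - yf)"
  using assms(2)
proof (induction \<pi> arbitrary: z)
  case (Cons u \<pi>)
  have "vdp U nxt yf (length (u # \<pi>)) z \<le> vdp U nxt yf (length \<pi>) (nxt u z)"
    using Cons.prems assms(1) by auto
  with Cons show ?case by (auto intro: order_trans)
qed simp

lemma length_pidp [simp]: "length (pidp sel nxt j z) = j"
  by (induction j arbitrary: z) auto

text \<open>The selected mode attains the minimum at each stage. The invariant set \<open>A\<close>
  is needed because \<open>sel\<close> is specified on grid points only.\<close>

lemma pidp_optimal:
  assumes "finite U" "U \<noteq> {}"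
    and nxt: "\<And>u z. u \<in> U \<Longrightarrow> z \<in> A \<Longrightarrow> nxt u z \<in> A"
    and sel: "\<And>j z. z \<in> A \<Longrightarrow> sel (Suc j) z \<in> U"
      "\<And>j z u. z \<in> A \<Longrightarrow> u \<in> U \<Longrightarrow> vdp U nxt yf j (nxt (sel (Suc j) z) z) \<le> vdp U nxt yf j (nxt u z)"
    and "z \<in> A"
  shows "set (pidp sel nxt j z) \<subseteq> U \<and> norm (fold nxt (pidp sel nxt j z) z - yf) = vdp U nxt yf j z"
  using assms(6)
proof (induction j arbitrary: z)
  case (Suc j)
  have "Min ((\<lambda>u. vdp U nxt yf j (nxt u z)) ` U) = vdp U nxt yf j (nxt (sel (Suc j) z) z)"
    using assms(1,2) sel Suc.prems by (intro Min_eqI) auto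
  with Suc nxt sel(1) show ?case by auto
qed simp

section \<open>The constants of the modes and the grid\<close>

text \<open>The infimum is itself admissible: by Cauchy-Schwarz \<open>l\<close> is an admissible
  constant, and for \<open>x \<noteq> y\<close> every admissible constant is at least the quotient
  of the inner product by the squared norm.\<close>

lemma osl_const_bound:
  assumes lip: "lipschitz_on l A F" and "x \<in> A" "y \<in> A"
  shows "inner (F x - F y) (x - y) \<le> osl_const F A * (norm (x - y))\<^sup>2"
proof (cases "x = y")
  case False
  let ?B = "{c. \<forall>y1\<in>A. \<forall>y2\<in>A. inner (F y1 - F y2) (y1 - y2) \<le> c * (norm (y1 - y2))\<^sup>2}"
  have "inner (F y1 - F y2) (y1 - y2) \<le> l * (norm (y1 - y2))\<^sup>2" if "y1 \<in> A" "y2 \<in> A" for y1 y2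
  proof -
    have "inner (F y1 - F y2) (y1 - y2) \<le> norm (F y1 - F y2) * norm (y1 - y2)"
      by (rule norm_cauchy_schwarz)
    also have "\<dots> \<le> l * norm (y1 - y2) * norm (y1 - y2)"
      using lipschitz_onD[OF lip that] by (intro mult_right_mono) (auto simp: dist_norm)
    finally show ?thesis by (simp add: power2_eq_square mult.assoc)
  qed
  then have "l \<in> ?B" by blast
  then have "inner (F x - F y) (x - y) / (norm (x - y))\<^sup>2 \<le> Inf ?B"
    using False assms(2,3) by (intro cInf_greatest) (auto simp: divide_le_eq)
  with False show ?thesis unfolding osl_const_def by (simp add: divide_le_eq)
qed simp

lemma C_const_bound:
  assumes "lipschitz_on l A F" "compact A" "x \<in> A"
  shows "l * norm (F x) \<le> C_const l F A"
proof -
  have "compact ((\<lambda>y. l * norm (F y)) ` A)"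
    using assms by (intro compact_continuous_image continuous_intros lipschitz_on_continuous_on)
  then show ?thesis unfolding C_const_def
    using assms(3) by (intro cSup_upper bounded_imp_bdd_above compact_imp_bounded) auto
qed

lemma cube_eq_cbox: "(cube :: (real^'m) set) = cbox 0 1"
  by (auto simp: cube_def mem_box_cart)

lemma osl_const_fmode: "osl_const (fmode L \<sigma> f u) A = osl_const (fmode L \<sigma> f v) A"
  by (simp add: osl_const_def fmode_def)

lemma grid_subset_cube: "grid K \<subseteq> (cube :: (real^'m) set)"
proof
  fix c :: "real^'m" assume "c \<in> grid K"
  have "0 \<le> c$i \<and> c$i \<le> 1" for i
  proof -
    obtain n where "n < K" "c$i = (real n + 1/2) / real K"
      using \<open>c \<in> grid K\<close> unfolding grid_def by blast
    then show ?thesis by (simp add: divide_le_eq)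
  qed
  then show "c \<in> cube" by (simp add: cube_def)
qed

text \<open>Half the diagonal of a cell is \<open>sqrt M / (2 * K)\<close>, where
  \<open>M = CARD('m)\<close>.\<close>

lemma in_cell_norm:
  fixes x c :: "real^'m"
  assumes "in_cell K c x" "0 < \<epsilon>" "real K \<ge> sqrt (real CARD('m)) / (2 * \<epsilon>)"
  shows "norm (x - c) \<le> \<epsilon>"
proof -
  have M: "0 < sqrt (real CARD('m))" by simp
  with assms(2) have "0 < sqrt (real CARD('m)) / (2 * \<epsilon>)" by simp
  with assms(3) have K: "0 < real K" by linarith
  have "norm (x - c) \<le> sqrt (\<Sum>i\<in>(UNIV::'m set). (1 / (2 * real K))\<^sup>2)"
    unfolding norm_vec_def L2_set_def using assms(1)
    by (intro real_sqrt_le_mono sum_mono power_mono) (auto simp: in_cell_def)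
  also have "\<dots> = sqrt (real CARD('m)) / (2 * real K)"
    using K by (simp add: real_sqrt_mult real_sqrt_divide power_divide)
  also have "\<dots> \<le> \<epsilon>" using assms(2,3) K by (simp add: field_simps)
  finally show ?thesis .
qed

text \<open>Below, \<open>z'\<close> is the next point of an Euler path with defect \<open>\<eta>\<close>:
  0 for the plain scheme, \<open>\<epsilon>\<close> for the path rounded to the grid.\<close>

lemma traj_step:
  assumes tr: "is_traj \<tau> F \<pi> y X" and XS: "\<And>t. t \<in> {0..real (length \<pi>) * \<tau>} \<Longrightarrow> X t \<in> S"
    and j: "j < length \<pi>" and \<tau>: "0 < \<tau>"
    and one: "\<And>X. (\<And>t. t \<in> {0..\<tau>} \<Longrightarrow> (X has_vector_derivative F (\<pi>!j) (X t)) (at t within {0..\<tau>}))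
        \<Longrightarrow> (\<And>t. t \<in> {0..\<tau>} \<Longrightarrow> X t \<in> S)
        \<Longrightarrow> norm (X \<tau> - (z + \<tau> *\<^sub>R F (\<pi>!j) z)) \<le> E * norm (X 0 - z) + c"
    and z': "norm (z' - (z + \<tau> *\<^sub>R F (\<pi>!j) z)) \<le> \<eta>"
  shows "norm (X (real (Suc j) * \<tau>) - z') \<le> E * norm (X (real j * \<tau>) - z) + c + \<eta>"
proof -
  \<comment> \<open>A time shift moves the interval of index \<open>j\<close> to
    \<open>{0..\<tau>}\<close>, where \<open>one\<close> applies.\<close>
  define Z where "Z t = X (real j * \<tau> + t)" for t
  have j': "(real j + 1) * \<tau> \<le> real (length \<pi>) * \<tau>"
    using j \<tau> by (intro mult_right_mono) auto
  have "norm (Z \<tau> - (z + \<tau> *\<^sub>R F (\<pi>!j) z)) \<le> E * norm (Z 0 - z) + c"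
  proof (rule one)
    fix t assume t: "t \<in> {0..\<tau>}"
    have img: "(\<lambda>s. real j * \<tau> + s) ` {0..\<tau>} = {real j * \<tau>..real (Suc j) * \<tau>}"
      by (simp add: algebra_simps)
    have "(X has_vector_derivative F (\<pi>!j) (Z t)) (at (real j * \<tau> + t) within (\<lambda>s. real j * \<tau> + s) ` {0..\<tau>})"
      using tr j t unfolding is_traj_def img Z_def by (auto simp: algebra_simps)
    moreover have "((\<lambda>s. real j * \<tau> + s) has_vector_derivative 1) (at t within {0..\<tau>})"
      by (auto intro!: derivative_eq_intros)
    ultimately show "(Z has_vector_derivative F (\<pi>!j) (Z t)) (at t within {0..\<tau>})"
      using vector_diff_chain_within[of "\<lambda>s. real j * \<tau> + s" 1 t "{0..\<tau>}" X "F (\<pi>!j) (Z t)"]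
      by (simp add: o_def Z_def[abs_def])
    show "Z t \<in> S" unfolding Z_def using t \<tau> j' by (intro XS) (auto simp: algebra_simps)
  qed
  moreover have "norm (Z \<tau> - z') \<le> norm (Z \<tau> - (z + \<tau> *\<^sub>R F (\<pi>!j) z)) + norm (z' - (z + \<tau> *\<^sub>R F (\<pi>!j) z))"
    by (metis dist_norm dist_triangle2)
  ultimately show ?thesis using z' by (simp add: Z_def algebra_simps)
qed

section \<open>Accumulation of the errors over \<open>k\<close> steps\<close>

theorem theorem2:
  fixes L \<sigma> \<tau> \<epsilon> :: real and k K :: nat
    and f :: "real^('m::{finite,linorder}) \<Rightarrow> real^('m::{finite,linorder})"
    and U :: "mode set" and Lu :: "mode \<Rightarrow> real"
    and Y :: "mode list \<Rightarrow> real^('m::{finite,linorder}) \<Rightarrow> real \<Rightarrow> real^('m::{finite,linorder})"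
    and rep :: "real^('m::{finite,linorder}) \<Rightarrow> real^('m::{finite,linorder})"
    and sel :: "nat \<Rightarrow> real^('m::{finite,linorder}) \<Rightarrow> mode"
    and yf y :: "real^('m::{finite,linorder})"
  assumes k: "k \<ge> 1" and L: "L > 0" and \<sigma>: "\<sigma> > 0" and \<tau>: "\<tau> > 0" and \<epsilon>: "\<epsilon> > 0"
    and U: "finite U" "U \<noteq> {}" "U \<subseteq> {0..1} \<times> {0..1}"
    and lip: "\<forall>u\<in>U. lipschitz_on (Lu u) cube (fmode L \<sigma> f u)"
    and traj: "\<forall>\<pi> y0. set \<pi> \<subseteq> U \<and> length \<pi> = k \<and> y0 \<in> cube \<longrightarrow>
                 is_traj \<tau> (fmode L \<sigma> f) \<pi> y0 (Y \<pi> y0) \<and>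
                 (\<forall>t\<in>{0..real k * \<tau>}. Y \<pi> y0 t \<in> cube)"
    and euler: "\<forall>\<pi> z0. set \<pi> \<subseteq> U \<and> length \<pi> = k \<and> z0 \<in> cube \<longrightarrow>
                 (\<forall>t\<in>{0..real k * \<tau>}. euler_traj \<tau> (fmode L \<sigma> f) \<pi> z0 t \<in> cube)"
    and H: "\<forall>u\<in>U. hypH \<epsilon> \<tau> (osl_const (fmode L \<sigma> f u) cube)
                         (C_const (Lu u) (fmode L \<sigma> f u) cube)"
    and K: "real K \<ge> sqrt (real CARD('m::{finite,linorder})) / (2 * \<epsilon>)"
    and rep: "\<forall>x\<in>cube. rep x \<in> grid K \<and> in_cell K (rep x) x"
    and sel: "\<forall>j z. z \<in> grid K \<longrightarrow> sel (Suc j) z \<in> U \<and>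
                (\<forall>u\<in>U. vdp U (\<lambda>u z. rep (z + \<tau> *\<^sub>R fmode L \<sigma> f u z)) yf j
                           ((\<lambda>u z. rep (z + \<tau> *\<^sub>R fmode L \<sigma> f u z)) (sel (Suc j) z) z)
                        \<le> vdp U (\<lambda>u z. rep (z + \<tau> *\<^sub>R fmode L \<sigma> f u z)) yf j
                           ((\<lambda>u z. rep (z + \<tau> *\<^sub>R fmode L \<sigma> f u z)) u z))"
    and yf: "yf \<in> cube" and y: "y \<in> cube"
  shows "\<bar>norm (euler_traj \<tau> (fmode L \<sigma> f)
                 (pidp sel (\<lambda>u z. rep (z + \<tau> *\<^sub>R fmode L \<sigma> f u z)) k (rep y))
                 (rep y) (real k * \<tau>) - yf)
          - vexact \<tau> U Y yf k y\<bar> \<le> (2 * real k + 1) * \<epsilon>"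
proof -
  let ?F = "fmode L \<sigma> f" and ?S = "cube :: (real^('m::{finite,linorder})) set"
  let ?nxt = "\<lambda>u z. rep (z + \<tau> *\<^sub>R ?F u z)" and ?eul = "\<lambda>u z. z + \<tau> *\<^sub>R ?F u z"
  obtain u0 where "u0 \<in> U" using U(2) by blast
  define a where "a = - osl_const (?F u0) ?S"
  have osl_a: "osl_const (?F u) ?S = - a" for u
    unfolding a_def by (simp add: osl_const_fmode[of L \<sigma> f u ?S u0])
  define E where "E = exp (- a * \<tau>)"
  have a: "0 < a" using H \<open>u0 \<in> U\<close> by (auto simp: hypH_def Let_def osl_a)
  have E: "0 < E" "E \<le> 1" using a \<tau> by (auto simp: E_def)
  have \<tau>k: "\<tau> \<le> real k * \<tau>" using k \<tau> by simp
  \<comment> \<open>Invariance is assumed for words of length \<open>k\<close> only; a constant word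
    restricted to its first interval gives the single step.\<close>
  have seg: "z + t *\<^sub>R ?F u z \<in> ?S" if "u \<in> U" "z \<in> ?S" "t \<in> {0..\<tau>}" for u z t
  proof -
    have "euler_traj \<tau> ?F (replicate k u) z t \<in> ?S"
      using euler[rule_format, of "replicate k u" z t] that \<tau>k
      by (auto simp: set_replicate_conv_if)
    moreover obtain n where "k = Suc n" using k by (cases k) auto
    ultimately show ?thesis using that by simp
  qed
  have eulS: "?eul u z \<in> ?S" if "u \<in> U" "z \<in> ?S" for u z
    using seg[OF that, of \<tau>] \<tau> by auto
  have nxtG: "?nxt u z \<in> grid K" if "u \<in> U" "z \<in> ?S" for u z
    using rep eulS[OF that] by blast
  have nxtS: "?nxt u z \<in> ?S" if "u \<in> U" "z \<in> ?S" for u z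
    using nxtG[OF that] grid_subset_cube by blast
  have rnd: "norm (rep x - x) \<le> \<epsilon>" if "x \<in> ?S" for x
    using in_cell_norm[OF _ \<epsilon> K, of "rep x" x] rep that by (simp add: norm_minus_commute)
  have one: "norm (X \<tau> - ?eul u z) \<le> E * norm (X 0 - z) + (1 - E) * \<epsilon>"
    if u: "u \<in> U" and z: "z \<in> ?S"
      and X: "\<And>t. t \<in> {0..\<tau>} \<Longrightarrow> (X has_vector_derivative ?F u (X t)) (at t within {0..\<tau>})"
        "\<And>t. t \<in> {0..\<tau>} \<Longrightarrow> X t \<in> ?S"
    for u z X
  proof -
    let ?C = "C_const (Lu u) (?F u) ?S"
    have lu: "lipschitz_on (Lu u) ?S (?F u)" using lip u by blast
    have lC: "Lu u * norm (?F u z) \<le> ?C"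
      using C_const_bound[OF lu _ z] by (simp add: cube_eq_cbox)
    have C: "0 \<le> ?C"
      using lC lipschitz_on_nonneg[OF lu] by (meson mult_nonneg_nonneg norm_ge_zero order_trans)
    have "norm (X \<tau> - ?eul u z) \<le> E * norm (X 0 - z) + ?C * (a * \<tau> - 1 + E) / a\<^sup>2"
      unfolding E_def
      by (rule perturbed_osl_bound[OF \<tau> a C X(1) X(2) seg[OF u z] _ lu lC])
        (use osl_const_bound[OF lu] osl_a in auto)
    moreover have "?C * (a * \<tau> - 1 + E) / a\<^sup>2 \<le> (1 - E) * \<epsilon>"
      unfolding E_def using H u osl_a by (intro hypH_local_error \<tau> \<epsilon> C) auto
    ultimately show ?thesis by linarith
  qed
  have tstep: "norm (Y \<pi> y0 (real (Suc j) * \<tau>) - z')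
      \<le> E * norm (Y \<pi> y0 (real j * \<tau>) - z) + (1 - E) * \<epsilon> + \<eta>"
    if \<pi>: "set \<pi> \<subseteq> U" "length \<pi> = k" and "y0 \<in> ?S" and j: "j < k" and z: "z \<in> ?S"
      and "norm (z' - ?eul (\<pi>!j) z) \<le> \<eta>"
    for \<pi> y0 j z z' \<eta>
  proof (rule traj_step[where F = ?F and S = ?S])
    show "is_traj \<tau> ?F \<pi> y0 (Y \<pi> y0)" using traj that by blast
    show "Y \<pi> y0 t \<in> ?S" if "t \<in> {0..real (length \<pi>) * \<tau>}" for t
      using traj \<pi> \<open>y0 \<in> ?S\<close> that by blast
    have "\<pi>!j \<in> U" using \<pi> j by (auto intro: subsetD[OF _ nth_mem])
    then show "norm (X \<tau> - ?eul (\<pi>!j) z) \<le> E * norm (X 0 - z) + (1 - E) * \<epsilon>"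
      if "\<And>t. t \<in> {0..\<tau>} \<Longrightarrow> (X has_vector_derivative ?F (\<pi>!j) (X t)) (at t within {0..\<tau>})"
        "\<And>t. t \<in> {0..\<tau>} \<Longrightarrow> X t \<in> ?S" for X
      using one[OF _ z] that by blast
  qed (use that \<tau> in auto)
  have Y0: "Y \<pi> y0 0 = y0" if "set \<pi> \<subseteq> U" "length \<pi> = k" "y0 \<in> ?S" for \<pi> y0
    using traj that unfolding is_traj_def by blast
  \<comment> \<open>Both Euler images are compared with the exact flow from \<open>w\<close>. Each
    comparison costs \<open>(1 - E) * \<epsilon>\<close>, and the one with the image of
    \<open>w\<close> starts at distance 0.\<close>
  have estep: "norm (?eul u w - ?eul u z) \<le> E * norm (w - z) + 2 * (1 - E) * \<epsilon>"
    if u: "u \<in> U" and w: "w \<in> ?S" and z: "z \<in> ?S" for u w z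
  proof -
    let ?X = "Y (replicate k u) w"
    have p: "set (replicate k u) \<subseteq> U" "length (replicate k u) = k" "0 < k" using u k by auto
    have X0: "?X 0 = w" using Y0 p w by blast
    have *: "norm (?X \<tau> - ?eul u x) \<le> E * norm (w - x) + (1 - E) * \<epsilon>" if "x \<in> ?S" for x
      using tstep[OF p(1,2) w p(3) that, of "?eul u x" 0] p(3) X0 by simp
    have "norm (?eul u w - ?eul u z) \<le> norm (?X \<tau> - ?eul u w) + norm (?X \<tau> - ?eul u z)"
      using dist_triangle3[of "?eul u w" "?eul u z" "?X \<tau>"] unfolding dist_norm .
    with *[OF w] *[OF z] show ?thesis by (simp add: algebra_simps)
  qed
  define z0 where "z0 = rep y"
  have z0G: "z0 \<in> grid K" and z0: "z0 \<in> ?S" using rep y grid_subset_cube by (auto simp: z0_def)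
  have yz0: "norm (y - z0) \<le> \<epsilon>" using rnd[OF y] by (simp add: z0_def norm_minus_commute)
  have take_Suc_fold: "fold g (take (Suc j) \<pi>) z0 = g (\<pi>!j) (fold g (take j \<pi>) z0)"
    if "j < length \<pi>" for g :: "mode \<Rightarrow> real^('m::{finite,linorder}) \<Rightarrow> real^('m::{finite,linorder})" and \<pi> j
    using that by (simp add: take_Suc_conv_app_nth)
  have foldS: "fold g (take j \<pi>) z0 \<in> ?S"
    if "\<And>u z. u \<in> U \<Longrightarrow> z \<in> ?S \<Longrightarrow> g u z \<in> ?S" "set \<pi> \<subseteq> U" for g :: "mode \<Rightarrow> real^('m::{finite,linorder}) \<Rightarrow> real^('m::{finite,linorder})" and \<pi> j
    by (rule fold_invariant[where P = "\<lambda>z. z \<in> ?S" and Q = "\<lambda>u. u \<in> U"])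
      (use that z0 in \<open>auto dest: in_set_takeD\<close>)
  define P where "P = {\<pi>. set \<pi> \<subseteq> U \<and> length \<pi> = k}"
  have P: "finite P" "P \<noteq> {}"
    using finite_lists_length_eq[OF U(1)] \<open>u0 \<in> U\<close>
    by (auto simp: P_def intro!: exI[of _ "replicate k u0"])
  have v: "vexact \<tau> U Y yf k y = Min ((\<lambda>\<pi>. norm (Y \<pi> y (real k * \<tau>) - yf)) ` P)"
    by (simp add: vexact_def P_def)
  define p where "p = pidp sel ?nxt k z0"
  have "set p \<subseteq> U \<and> norm (fold ?nxt p z0 - yf) = vdp U ?nxt yf k z0"
    unfolding p_def
  proof (rule pidp_optimal[where A = "grid K"])
    show "?nxt u z \<in> grid K" if "u \<in> U" "z \<in> grid K" for u z
      using that grid_subset_cube by (intro nxtG) blast+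
    show "sel (Suc j) z \<in> U" if "z \<in> grid K" for j z
      using sel that by blast
    show "vdp U ?nxt yf j (?nxt (sel (Suc j) z) z) \<le> vdp U ?nxt yf j (?nxt u z)"
      if "z \<in> grid K" "u \<in> U" for j z u
      using sel that by blast
  qed (use U z0G in auto)
  then have p: "set p \<subseteq> U" "length p = k" and popt: "norm (fold ?nxt p z0 - yf) = vdp U ?nxt yf k z0"
    by (auto simp: p_def)
  define w where "w j = fold ?eul (take j p) z0" for j
  define x where "x j = fold ?nxt (take j p) z0" for j
  have wS: "w j \<in> ?S" and xS: "x j \<in> ?S" for j
    unfolding w_def x_def using eulS nxtS p by (auto intro!: foldS)
  have w_Suc: "w (Suc j) = ?eul (p!j) (w j)" and x_Suc: "x (Suc j) = ?nxt (p!j) (x j)" if "j < k" for j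
    unfolding w_def x_def using take_Suc_fold p that by auto
  have pU: "p!j \<in> U" if "j < k" for j using p that by (auto intro: subsetD[OF _ nth_mem])
  have euler_w: "euler_traj \<tau> ?F p z0 (real k * \<tau>) = w k"
    using euler_traj_end[OF \<tau>, of ?F p z0] p by (simp add: w_def)

  \<comment> \<open>Without rounding the tube of radius \<open>\<epsilon>\<close> is invariant, so
    this direction loses only one \<open>\<epsilon>\<close>.\<close>
  have "norm (Y p y (real j * \<tau>) - w j) \<le> \<epsilon>" if "j \<le> k" for j
    using that
  proof (induction j)
    case 0
    then show ?case using Y0[OF p y] yz0 by (simp add: w_def)
  next
    case (Suc j)
    have "norm (Y p y (real (Suc j) * \<tau>) - w (Suc j)) \<le> E * norm (Y p y (real j * \<tau>) - w j) + (1 - E) * \<epsilon> + 0"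
      using Suc.prems by (intro tstep p y wS) (auto simp: w_Suc)
    also have "\<dots> \<le> E * \<epsilon> + (1 - E) * \<epsilon> + 0"
      using Suc E by (intro add_right_mono mult_left_mono) auto
    finally show ?case by (simp add: algebra_simps)
  qed
  from this[of k] have "norm (Y p y (real k * \<tau>) - yf) \<le> norm (w k - yf) + \<epsilon>"
    using dist_triangle[of "Y p y (real k * \<tau>)" yf "w k"] unfolding dist_norm by simp
  moreover have "vexact \<tau> U Y yf k y \<le> norm (Y p y (real k * \<tau>) - yf)"
    unfolding v using P p by (intro Min_le) (auto simp: P_def)
  ultimately have lower: "vexact \<tau> U Y yf k y \<le> norm (w k - yf) + \<epsilon>" by linarith

  \<comment> \<open>For the other direction, an optimal exact pattern \<open>q\<close> is followed
    on the grid by \<open>x'\<close> and competes with \<open>p\<close> in the dynamic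
    program.\<close>
  have "vexact \<tau> U Y yf k y \<in> (\<lambda>\<pi>. norm (Y \<pi> y (real k * \<tau>) - yf)) ` P"
    unfolding v using P by (intro Min_in) auto
  then obtain q where q: "set q \<subseteq> U" "length q = k"
    and vq: "vexact \<tau> U Y yf k y = norm (Y q y (real k * \<tau>) - yf)" by (auto simp: P_def)
  define x' where "x' j = fold ?nxt (take j q) z0" for j
  have x'S: "x' j \<in> ?S" for j unfolding x'_def using nxtS q by (auto intro!: foldS)
  have x'_Suc: "x' (Suc j) = ?nxt (q!j) (x' j)" if "j < k" for j
    unfolding x'_def using take_Suc_fold q that by auto
  have qU: "q!j \<in> U" if "j < k" for j using q that by (auto intro: subsetD[OF _ nth_mem])
  define D where "D j = norm (Y q y (real j * \<tau>) - x' j)" for j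
  define r where "r j = norm (w j - x j)" for j
  have D_Suc: "D (Suc j) \<le> E * D j + (1 - E) * \<epsilon> + \<epsilon>" if "j < k" for j
    unfolding D_def x'_Suc[OF that] using that by (intro tstep q y x'S rnd eulS qU)
  have D0: "D 0 \<le> \<epsilon>" using Y0[OF q y] yz0 by (simp add: D_def x'_def)
  have r_Suc: "r (Suc j) \<le> norm (?eul (p!j) (w j) - ?eul (p!j) (x j)) + \<epsilon>" if "j < k" for j
  proof -
    have "r (Suc j) \<le> norm (?eul (p!j) (w j) - ?eul (p!j) (x j)) + norm (?nxt (p!j) (x j) - ?eul (p!j) (x j))"
      unfolding r_def w_Suc[OF that] x_Suc[OF that]
      using dist_triangle2[of "?eul (p!j) (w j)" "?nxt (p!j) (x j)" "?eul (p!j) (x j)"]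
      unfolding dist_norm .
    also have "\<dots> \<le> norm (?eul (p!j) (w j) - ?eul (p!j) (x j)) + \<epsilon>"
      by (intro add_left_mono rnd eulS pU that xS)
    finally show ?thesis .
  qed
  have "D (Suc j) + r (Suc j) \<le> (2 * real (Suc j) + 1) * \<epsilon>" if "j < k" for j
    using that
  proof (induction j)
    case 0
    have "D 1 \<le> E * \<epsilon> + (1 - E) * \<epsilon> + \<epsilon>"
      using D_Suc[OF 0] mult_left_mono[OF D0 less_imp_le[OF E(1)]] unfolding One_nat_def by linarith
    moreover have "r 1 \<le> \<epsilon>" using r_Suc[OF 0] by (simp add: w_def x_def)
    ultimately show ?case by (simp add: algebra_simps)
  next
    case (Suc j)
    define B where "B = (2 * real (Suc j) + 1) * \<epsilon>"
    have IH: "D (Suc j) + r (Suc j) \<le> B" using Suc by (simp add: B_def)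
    have "r (Suc (Suc j)) \<le> E * r (Suc j) + 2 * (1 - E) * \<epsilon> + \<epsilon>"
      using r_Suc[OF Suc.prems] estep[OF pU[OF Suc.prems] wS xS, of "Suc j" "Suc j"] by (simp add: r_def)
    then have "D (Suc (Suc j)) + r (Suc (Suc j)) \<le> E * (D (Suc j) + r (Suc j)) + (1 - E) * (3 * \<epsilon>) + 2 * \<epsilon>"
      using D_Suc[OF Suc.prems] by (simp add: algebra_simps)
    also have "\<dots> \<le> E * B + (1 - E) * B + 2 * \<epsilon>"
    proof -
      \<comment> \<open>The local errors of \<open>D\<close> and \<open>r\<close> add up to
        \<open>(1 - E) * (3 * \<epsilon>)\<close>. Since the index is at least 1, \<open>B\<close>
        dominates \<open>3 * \<epsilon>\<close>, and the convex combination stays below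
        \<open>B\<close>.\<close>
      have "3 * \<epsilon> \<le> B" unfolding B_def using \<epsilon> by (intro mult_right_mono) auto
      then show ?thesis using IH E by (intro add_mono mult_left_mono) auto
    qed
    also have "\<dots> = B + 2 * \<epsilon>" by (simp add: algebra_simps)
    finally show ?case by (simp add: B_def algebra_simps)
  qed
  from this[of "k - 1"] have Dr: "D k + r k \<le> (2 * real k + 1) * \<epsilon>" using k by simp
  \<comment> \<open>Optimality of \<open>p\<close> on the grid links the two paths: from
    \<open>w k\<close> to \<open>x k\<close> at cost \<open>r k\<close>, then over to
    \<open>x' k\<close>, then to the exact endpoint at cost \<open>D k\<close>.\<close>
  have "norm (x k - yf) \<le> norm (x' k - yf)"
    using vdp_le[OF U(1) q(1), of ?nxt yf z0] popt p q by (simp add: x_def x'_def)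
  moreover have "norm (x' k - yf) \<le> D k + vexact \<tau> U Y yf k y"
    unfolding D_def vq using dist_triangle3[of "x' k" yf "Y q y (real k * \<tau>)"] unfolding dist_norm .
  moreover have "norm (w k - yf) \<le> r k + norm (x k - yf)"
    unfolding r_def using dist_triangle[of "w k" yf "x k"] unfolding dist_norm .
  ultimately have upper: "norm (w k - yf) \<le> vexact \<tau> U Y yf k y + (2 * real k + 1) * \<epsilon>"
    using Dr by linarith
  have "\<epsilon> \<le> (2 * real k + 1) * \<epsilon>" using \<epsilon> by simp
  with lower upper show ?thesis
    unfolding z0_def[symmetric] p_def[symmetric] euler_w by (simp add: abs_le_iff)
qed

end
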